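(* Let $t\ge 3$ be an integer. Then for all $n$ sufficiently large (with respect to $t$), $$\mathrm{sat}_t(n,\mathcal{C}_2(K_{1,3}))<\mathrm{sat}_t(n,\mathcal{C}_1(K_{1,3}))<\mathrm{sat}_t(n,\mathcal{C}_3(K_{1,3})).$$
   Context: All graphs are finite and simple. Write $[t]=\{1,\dots,t\}$. A $t$-edge-coloring of a graph $G$ is an arbitrary function $E(G)\to[t]$ (not necessarily proper). Given a family $\mathcal{C}$ of graphs edge-colored from $[t]$, a $t$-edge-colored graph $G$ is $(\mathcal{C},t)$-saturated if $G$ contains no member of $\mathcal{C}$ as a colored subgraph (not necessarily induced, colors matching), but for every non-edge $e\in E(\overline{G})$ and every color $i\in[t]$, adding $e$ to $G$ in color $i$ creates a colored subgraph that is a member of $\mathcal{C}$. The number $\mathrm{sat}_t(n,\mathcal{C})$ is the minimum number of edges in a $(\mathcal{C},t)$-saturated graph on $n$ vertices. For a graph $H$, $\mathcal{C}_r(H)$ is the family of all edge-colorings of $H$ with colors from $[t]$ that use exactly $r$ colors. $K_{1,3}$ is the star with three edges. *)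

theory Defs
  imports Main
begin

record 'a graph =
  verts :: "'a set"
  edges :: "'a set set"

definition simple_graph :: "('a, 'b) graph_scheme \<Rightarrow> bool" where
  "simple_graph G \<longleftrightarrow> finite (verts G) \<and> edges G \<subseteq> {e. e \<subseteq> verts G \<and> card e = 2}"

definition non_edges :: "('a, 'b) graph_scheme \<Rightarrow> 'a set set" where
  "non_edges G = {e. e \<subseteq> verts G \<and> card e = 2 \<and> e \<notin> edges G}"

text \<open>Values of \<open>color\<close> outside \<open>edges\<close> carry no meaning; no definition below depends on them.\<close>

record 'a colored_graph = "'a graph" +
  color :: "'a set \<Rightarrow> nat"

definition edge_colored_graph :: "nat \<Rightarrow> 'a colored_graph \<Rightarrow> bool" where
  "edge_colored_graph t G \<longleftrightarrow> simple_graph G \<and> (\<forall>e \<in> edges G. color G e \<in> {1..t})"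

definition add_edge :: "'a set \<Rightarrow> nat \<Rightarrow> 'a colored_graph \<Rightarrow> 'a colored_graph" where
  "add_edge e i G = G\<lparr>edges := insert e (edges G), color := (color G)(e := i)\<rparr>"

text \<open>\<open>G\<close> has a (not necessarily induced) subgraph that is isomorphic to \<open>H\<close> with matching colors.
  The colors themselves may not be permuted.\<close>

definition contains_copy :: "'a colored_graph \<Rightarrow> 'b colored_graph \<Rightarrow> bool" where
  "contains_copy G H \<longleftrightarrow>
     (\<exists>f. inj_on f (verts H) \<and> f ` verts H \<subseteq> verts G \<and>
        (\<forall>e \<in> edges H. f ` e \<in> edges G \<and> color G (f ` e) = color H e))"

definition contains_member :: "'a colored_graph \<Rightarrow> 'b colored_graph set \<Rightarrow> bool" where
  "contains_member G \<C> \<longleftrightarrow> (\<exists>H \<in> \<C>. contains_copy G H)"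

definition saturated :: "nat \<Rightarrow> 'b colored_graph set \<Rightarrow> 'a colored_graph \<Rightarrow> bool" where
  "saturated t \<C> G \<longleftrightarrow>
     edge_colored_graph t G \<and>
     \<not> contains_member G \<C> \<and>
     (\<forall>e \<in> non_edges G. \<forall>i \<in> {1..t}. contains_member (add_edge e i G) \<C>)"

text \<open>Host graphs have natural numbers as vertices, which loses nothing up to isomorphism.
  The set of edge counts is nonempty as soon as every member of \<open>\<C>\<close> has an edge
  (\<open>saturated_exists\<close> below), so the infimum is then an attained minimum.\<close>

definition sat_number :: "nat \<Rightarrow> nat \<Rightarrow> 'b colored_graph set \<Rightarrow> nat" where
  "sat_number t n \<C> =
     Inf {card (edges G) | G :: nat colored_graph. saturated t \<C> G \<and> card (verts G) = n}"

definition colorings :: "nat \<Rightarrow> nat \<Rightarrow> 'a graph \<Rightarrow> 'a colored_graph set" where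
  "colorings t r H =
     {G. verts G = verts H \<and> edges G = edges H \<and> edge_colored_graph t G \<and>
         card (color G ` edges G) = r}"

definition star_graph :: "nat \<Rightarrow> nat graph" where
  "star_graph k = \<lparr>verts = {0..k}, edges = {{0, j} | j. j \<in> {1..k}}\<rparr>"

lemma saturated_exists:
  fixes \<C> :: "'b colored_graph set"
  assumes "\<And>H. H \<in> \<C> \<Longrightarrow> edges H \<noteq> {}"
  shows "\<exists>G :: nat colored_graph. saturated t \<C> G \<and> card (verts G) = n"
proof -
  define P where "P G \<longleftrightarrow> verts G = {..<n} \<and> edge_colored_graph t G \<and> \<not> contains_member G \<C>"
    for G :: "nat colored_graph"
  have "P \<lparr>verts = {..<n}, edges = {}, color = (\<lambda>_. 1)\<rparr>"
    using assms unfolding P_def edge_colored_graph_def simple_graph_def contains_member_def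
      contains_copy_def by fastforce
  moreover have sub: "edges G \<subseteq> Pow {..<n}" if "P G" for G
    using that unfolding P_def edge_colored_graph_def simple_graph_def by auto
  then have "\<forall>G. P G \<longrightarrow> card (edges G) < Suc (card (Pow {..<n}))"
    by (metis card_mono finite_Pow_iff finite_lessThan less_Suc_eq_le)
  ultimately obtain G where G: "P G" and max: "\<And>G'. P G' \<Longrightarrow> card (edges G') \<le> card (edges G)"
    using ex_has_greatest_nat[of P _ "\<lambda>G. card (edges G)"] by blast
  have fin: "finite (edges G)"
    using sub[OF G] finite_subset by blast
  have "contains_member (add_edge e i G) \<C>" if e: "e \<in> non_edges G" and i: "i \<in> {1..t}" for e i
  proof (rule ccontr)
    assume "\<not> contains_member (add_edge e i G) \<C>"
    then have "P (add_edge e i G)"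
      using G e i unfolding P_def edge_colored_graph_def simple_graph_def add_edge_def non_edges_def
      by auto
    then have "card (insert e (edges G)) \<le> card (edges G)"
      using max[of "add_edge e i G"] by (simp add: add_edge_def)
    then show False
      using fin e by (simp add: non_edges_def)
  qed
  then have "saturated t \<C> G \<and> card (verts G) = n"
    using G unfolding saturated_def P_def by auto
  then show ?thesis
    by blast
qed

lemma colorings_edges_nonempty:
  assumes "r > 0" "H \<in> colorings t r K"
  shows "edges H \<noteq> {}"
  using assms by (auto simp: colorings_def)

end

theory Submission
  imports Defs
begin

text \<open>The three saturation numbers separate already by their leading terms. In a star-free graph,
  adding a non-edge \<open>uv\<close> in color \<open>i\<close> creates a forbidden star exactly if one of the two endpoints
  \<^emph>\<open>blocks\<close> \<open>i\<close>, that is, some of the edges that it already has are completed to such a star by one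
  more edge of color \<open>i\<close> (\<open>new_star_iff_blocks\<close>). So saturation becomes a condition on the colors
  seen at single vertices.

  \<^item> One color. A star-free graph has at most two edges of each color at each vertex, hence at
    most \<open>t * n\<close> edges. In a saturated graph the vertices with fewer than two edges of color \<open>i\<close>
    form a clique, since none of them blocks \<open>i\<close>. Degrees are at most \<open>2 * t\<close>, so this clique is
    small, and \<open>t * n\<close> is the right count up to a constant
    (\<open>mono_star_free_card_edges_le\<close>, \<open>mono_star_saturated_card_edges_ge\<close>).
  \<^item> Two colors. In a properly colored graph all stars are rainbow, and a vertex that sees every
    color blocks every color. A properly \<open>t\<close>-colored \<open>t\<close>-regular graph, with one more isolated
    vertex if \<open>n\<close> is odd, is therefore saturated; it has only about \<open>t * n / 2\<close> edges
    (\<open>two_colored_star_saturated_exists\<close>).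
  \<^item> Three colors. Two vertices that see the same set of colors must be adjacent, because
    neither blocks a color that it sees. There are at most \<open>2 ^ t\<close> such sets, so some clique
    contains a constant fraction of the vertices and the number of edges is quadratic
    (\<open>rainbow_star_saturated_card_edges\<close>).\<close>

section \<open>Stars as sets of incident edges\<close>

definition incident_edges :: "('a, 'b) graph_scheme \<Rightarrow> 'a \<Rightarrow> 'a set set" where
  "incident_edges G v = {e \<in> edges G. v \<in> e}"

definition has_star :: "nat \<Rightarrow> nat \<Rightarrow> 'a colored_graph \<Rightarrow> bool" where
  "has_star k r G \<longleftrightarrow>
     (\<exists>c \<in> verts G. \<exists>F \<subseteq> incident_edges G c. card F = k \<and> card (color G ` F) = r)"

definition blocks :: "nat \<Rightarrow> nat \<Rightarrow> 'a colored_graph \<Rightarrow> 'a \<Rightarrow> nat \<Rightarrow> bool" where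
  "blocks k r G v i \<longleftrightarrow>
     (\<exists>F \<subseteq> incident_edges G v. Suc (card F) = k \<and> card (insert i (color G ` F)) = r)"

lemma finite_edges:
  assumes "simple_graph G"
  shows "finite (edges G)"
proof -
  have "edges G \<subseteq> Pow (verts G)" "finite (verts G)"
    using assms by (auto simp: simple_graph_def)
  then show ?thesis
    by (meson finite_Pow_iff finite_subset)
qed

lemma finite_incident_edges:
  assumes "simple_graph G"
  shows "finite (incident_edges G v)"
  using finite_edges[OF assms] by (simp add: incident_edges_def)

lemma incident_edgesE:
  assumes "simple_graph G" "e \<in> incident_edges G v"
  obtains x where "e = {v, x}" "x \<noteq> v" "x \<in> verts G"
proof -
  have "card e = 2" "v \<in> e" "e \<subseteq> verts G"
    using assms by (auto simp: simple_graph_def incident_edges_def)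
  then obtain a b where "e = {a, b}" "a \<noteq> b"
    by (meson card_2_iff)
  then show thesis
    using that \<open>v \<in> e\<close> \<open>e \<subseteq> verts G\<close> by blast
qed

lemma color_star_edges:
  "(\<lambda>j. g {0, j}) ` {1..k} = g ` edges (star_graph k)"
proof -
  have "edges (star_graph k) = (\<lambda>j. {0, j}) ` {1..k}"
    by (auto simp: star_graph_def)
  then show ?thesis
    by (simp add: image_image)
qed

text \<open>A star in a simple graph is nothing but a set of edges at a common vertex. Its colors may be
  transported back to the pattern \<open>star_graph k\<close>, and whether the result belongs to the forbidden
  family depends only on how many colors there are.\<close>

lemma contains_star_iff:
  assumes G: "edge_colored_graph t G" and k: "k > 0"
  shows "contains_member G (colorings t r (star_graph k)) \<longleftrightarrow> has_star k r G"
proof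
  assume "contains_member G (colorings t r (star_graph k))"
  then obtain H where H_coloring: "H \<in> colorings t r (star_graph k)" and "contains_copy G H"
    by (auto simp: contains_member_def)
  then obtain f where copy_H: "inj_on f (verts H)" "f ` verts H \<subseteq> verts G"
    and "\<forall>e \<in> edges H. f ` e \<in> edges G \<and> color G (f ` e) = color H e"
    unfolding contains_copy_def by auto
  then have copy: "f ` e \<in> edges G \<and> color G (f ` e) = color H e" if "e \<in> edges H" for e
    using that by simp
  have H: "verts H = {0..k}" "edges H = edges (star_graph k)" "card (color H ` edges H) = r"
    using H_coloring by (auto simp: colorings_def star_graph_def)
  then have inj: "inj_on f {0..k}" and f: "f ` {0..k} \<subseteq> verts G"
    using copy_H by auto
  have edge: "{0, j} \<in> edges H" if "j \<in> {1..k}" for j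
    using that H by (auto simp: star_graph_def)
  define F where "F = (\<lambda>j. {f 0, f j}) ` {1..k}"
  have "inj_on (\<lambda>j. {f 0, f j}) {1..k}"
    using inj by (auto simp: inj_on_def doubleton_eq_iff)
  then have "card F = k"
    by (simp add: F_def card_image)
  moreover have "F \<subseteq> incident_edges G (f 0)"
    using copy[OF edge] by (auto simp: F_def incident_edges_def)
  moreover have "color G ` F = (\<lambda>j. color H {0, j}) ` {1..k}"
    using copy[OF edge] by (auto simp: F_def image_image)
  then have "card (color G ` F) = r"
    using H(2,3) by (simp only: color_star_edges)
  moreover have "f 0 \<in> verts G"
    using f by auto
  ultimately show "has_star k r G"
    unfolding has_star_def by blast
next
  assume "has_star k r G"
  then obtain c F where c: "c \<in> verts G" and F: "F \<subseteq> incident_edges G c" "card F = k"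
    "card (color G ` F) = r"
    unfolding has_star_def by blast
  have simple: "simple_graph G"
    using G by (simp add: edge_colored_graph_def)
  have "finite F"
    using F k by (metis card.infinite less_numeral_extra(3))
  then obtain h where h: "bij_betw h {1..k} F"
    using F(2) by (metis bij_betw_iff_card card_atLeastAtMost diff_Suc_1 finite_atLeastAtMost)
  have "\<exists>x. h j = {c, x} \<and> x \<noteq> c \<and> x \<in> verts G" if "j \<in> {1..k}" for j
    using h that F(1) incident_edgesE[OF simple] by (metis bij_betwE subsetD)
  then obtain g where g: "\<And>j. j \<in> {1..k} \<Longrightarrow> h j = {c, g j} \<and> g j \<noteq> c \<and> g j \<in> verts G"
    by metis
  define f where "f = g(0 := c)"
  have f: "f ` {0, j} = h j" if "j \<in> {1..k}" for j
    using g[OF that] that by (auto simp: f_def)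
  define H where
    "H = \<lparr>verts = {0..k}, edges = edges (star_graph k), color = (\<lambda>e. color G (f ` e))\<rparr>"
  have copy: "f ` e \<in> edges G \<and> color G (f ` e) = color H e" if e: "e \<in> edges H" for e
  proof -
    obtain j where "j \<in> {1..k}" "e = {0, j}"
      using e by (auto simp: H_def star_graph_def)
    moreover have "h j \<in> incident_edges G c"
      using bij_betwE[OF h] F(1) \<open>j \<in> {1..k}\<close> by blast
    ultimately show ?thesis
      using f[of j] by (simp add: H_def incident_edges_def)
  qed
  have inj_g: "inj_on g {1..k}"
  proof (rule inj_onI)
    fix a b assume ab: "a \<in> {1..k}" "b \<in> {1..k}" "g a = g b"
    then have "h a = h b"
      using g[of a] g[of b] by simp
    then show "a = b"
      using inj_onD[OF bij_betw_imp_inj_on[OF h]] ab by blast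
  qed
  have inj: "inj_on f {0..k}"
  proof (rule inj_onI)
    fix a b assume ab: "a \<in> {0..k}" "b \<in> {0..k}" "f a = f b"
    consider "a = 0" "b = 0" | "a = 0" "b \<in> {1..k}" | "a \<in> {1..k}" "b = 0"
      | "a \<in> {1..k}" "b \<in> {1..k}"
      using ab by fastforce
    then show "a = b"
    proof cases
      case 2
      then show ?thesis
        using ab(3) g[of b] by (simp add: f_def)
    next
      case 3
      then show ?thesis
        using ab(3) g[of a] by (simp add: f_def)
    next
      case 4
      then show ?thesis
        using ab(3) inj_onD[OF inj_g, of a b] by (simp add: f_def)
    qed simp
  qed
  have "f ` {0..k} \<subseteq> verts G"
    using g c by (auto simp: f_def)
  then have "contains_copy G H"
    using inj copy unfolding contains_copy_def by (intro exI[of _ f]) (simp add: H_def)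
  moreover have "simple_graph H"
    by (auto simp: simple_graph_def H_def star_graph_def)
  moreover have "color H e \<in> {1..t}" if "e \<in> edges H" for e
    using copy[OF that] G by (metis edge_colored_graph_def)
  moreover have "color H ` edges H = color G ` F"
  proof -
    have "color H ` edges H = (\<lambda>j. color H {0, j}) ` {1..k}"
      unfolding color_star_edges by (simp add: H_def)
    also have "\<dots> = (\<lambda>j. color G (h j)) ` {1..k}"
      using f by (auto simp: H_def)
    also have "\<dots> = color G ` F"
      using bij_betw_imp_surj_on[OF h] by (simp only: image_image[symmetric])
    finally show ?thesis .
  qed
  ultimately have "H \<in> colorings t r (star_graph k)" "contains_copy G H"
    using F(3) by (auto simp: colorings_def edge_colored_graph_def H_def star_graph_def)
  then show "contains_member G (colorings t r (star_graph k))"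
    unfolding contains_member_def by blast
qed

section \<open>Saturation as a condition on single vertices\<close>

lemma edge_colored_graph_add_edge:
  assumes "edge_colored_graph t G" "e \<in> non_edges G" "i \<in> {1..t}"
  shows "edge_colored_graph t (add_edge e i G)"
  using assms unfolding edge_colored_graph_def simple_graph_def non_edges_def add_edge_def by auto

text \<open>A new star must use the new edge, so its center is an endpoint of that edge; the remaining
  edges of the star were there before.\<close>

lemma new_star_iff_blocks:
  assumes G: "simple_graph G" and nostar: "\<not> has_star k r G" and k: "k > 0"
    and uv: "{u, v} \<in> non_edges G"
  shows "has_star k r (add_edge {u, v} i G) \<longleftrightarrow> blocks k r G u i \<or> blocks k r G v i"
proof -
  let ?e = "{u, v}" and ?G = "add_edge {u, v} i G"
  have new: "?e \<notin> edges G" and verts: "u \<in> verts G" "v \<in> verts G"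
    using uv by (auto simp: non_edges_def)
  have color: "color ?G ` F = color G ` F" if "?e \<notin> F" for F
    using that by (auto simp: add_edge_def)
  have color_insert: "color ?G ` insert ?e F = insert i (color G ` F)" if "?e \<notin> F" for F
    unfolding image_insert color[OF that] by (simp add: add_edge_def)
  have verts_new: "verts ?G = verts G"
    by (simp add: add_edge_def)
  have inc: "incident_edges ?G w =
      (if w \<in> ?e then insert ?e (incident_edges G w) else incident_edges G w)" for w
    by (auto simp: incident_edges_def add_edge_def)
  show ?thesis
  proof
    assume "has_star k r ?G"
    then obtain c F where c: "c \<in> verts G" and F: "F \<subseteq> incident_edges ?G c" "card F = k"
      "card (color ?G ` F) = r"
      unfolding has_star_def verts_new by blast
    have "?e \<in> F"
    proof (rule ccontr)
      assume e: "?e \<notin> F"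
      then have "F \<subseteq> incident_edges G c"
        using F(1) inc[of c] by (auto split: if_splits)
      then show False
        using nostar c F color[OF e] unfolding has_star_def by metis
    qed
    then have ce: "c \<in> ?e"
      using F(1) by (auto simp: incident_edges_def)
    have "F - {?e} \<subseteq> incident_edges G c"
      using F(1) inc[of c] by (auto split: if_splits)
    moreover have "Suc (card (F - {?e})) = k"
      using F(2) k \<open>?e \<in> F\<close> by (metis card.infinite card.remove less_numeral_extra(3))
    moreover have "card (insert i (color G ` (F - {?e}))) = r"
      using F(3) color_insert[of "F - {?e}"] \<open>?e \<in> F\<close> by (simp add: insert_absorb)
    ultimately have "blocks k r G c i"
      unfolding blocks_def by blast
    then show "blocks k r G u i \<or> blocks k r G v i"
      using ce by auto
  next
    have "has_star k r ?G" if w: "w \<in> ?e" and "blocks k r G w i" for w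
    proof -
      obtain F where F: "F \<subseteq> incident_edges G w" "Suc (card F) = k"
        "card (insert i (color G ` F)) = r"
        using \<open>blocks k r G w i\<close> unfolding blocks_def by blast
      have e: "?e \<notin> F"
        using F(1) new by (auto simp: incident_edges_def)
      have "finite F"
        using finite_incident_edges[OF G] F(1) finite_subset by blast
      then have "card (insert ?e F) = k"
        using e F(2) by simp
      moreover have "insert ?e F \<subseteq> incident_edges ?G w"
        using w F(1) inc[of w] by auto
      moreover have "card (color ?G ` insert ?e F) = r"
        using color_insert[OF e] F(3) by simp
      moreover have "w \<in> verts ?G"
        using w verts by (auto simp: verts_new)
      ultimately show ?thesis
        unfolding has_star_def by blast
    qed
    then show "blocks k r G u i \<or> blocks k r G v i \<Longrightarrow> has_star k r ?G"
      by auto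
  qed
qed

lemma saturated_star_iff:
  assumes k: "k > 0"
  shows "saturated t (colorings t r (star_graph k)) G \<longleftrightarrow>
    edge_colored_graph t G \<and> \<not> has_star k r G \<and>
    (\<forall>u v. {u, v} \<in> non_edges G \<longrightarrow> (\<forall>i \<in> {1..t}. blocks k r G u i \<or> blocks k r G v i))"
    (is "_ \<longleftrightarrow> ?R")
proof -
  let ?C = "colorings t r (star_graph k)"
  have pair: "(\<forall>e \<in> non_edges G. P e) \<longleftrightarrow> (\<forall>u v. {u, v} \<in> non_edges G \<longrightarrow> P {u, v})" for P
  proof -
    have "\<exists>u v. e = {u, v}" if "e \<in> non_edges G" for e
      using that by (auto simp: non_edges_def card_2_iff)
    then show ?thesis
      by metis
  qed
  have "contains_member (add_edge {u, v} i G) ?C \<longleftrightarrow> blocks k r G u i \<or> blocks k r G v i"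
    if "edge_colored_graph t G" "\<not> has_star k r G" "{u, v} \<in> non_edges G" "i \<in> {1..t}" for u v i
    using that contains_star_iff[OF edge_colored_graph_add_edge k] new_star_iff_blocks[OF _ _ k]
    by (metis edge_colored_graph_def)
  then show ?thesis
    unfolding saturated_def pair using contains_star_iff[OF _ k] by (smt (verit))
qed

section \<open>Counting edges\<close>

lemma handshake:
  assumes "finite V" "E \<subseteq> {e. e \<subseteq> V \<and> card e = 2}"
  shows "(\<Sum>v\<in>V. card {e \<in> E. v \<in> e}) = 2 * card E"
proof -
  have "E \<subseteq> Pow V"
    using assms(2) by auto
  then have "finite E"
    using assms(1) by (meson finite_Pow_iff finite_subset)
  moreover have "card {v \<in> V. v \<in> e} = 2" if "e \<in> E" for e
  proof -
    have "{v \<in> V. v \<in> e} = e"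
      using assms(2) that by auto
    then show ?thesis
      using assms(2) that by auto
  qed
  ultimately show ?thesis
    using sum_multicount[of V E "\<lambda>v e. v \<in> e" 2] assms(1) by simp
qed

lemma degree_sum:
  assumes "simple_graph G"
  shows "(\<Sum>v\<in>verts G. card (incident_edges G v)) = 2 * card (edges G)"
  using handshake[of "verts G" "edges G"] assms
  by (simp add: simple_graph_def incident_edges_def)

definition color_class :: "'a colored_graph \<Rightarrow> nat \<Rightarrow> 'a set set" where
  "color_class G i = {e \<in> edges G. color G e = i}"

definition color_degree :: "'a colored_graph \<Rightarrow> nat \<Rightarrow> 'a \<Rightarrow> nat" where
  "color_degree G i v = card {e \<in> incident_edges G v. color G e = i}"

lemma color_degree_sum:
  assumes "simple_graph G"
  shows "(\<Sum>v\<in>verts G. color_degree G i v) = 2 * card (color_class G i)"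
proof -
  have "{e \<in> incident_edges G v. color G e = i} = {e \<in> color_class G i. v \<in> e}" for v
    by (auto simp: incident_edges_def color_class_def)
  then show ?thesis
    using handshake[of "verts G" "color_class G i"] assms
    by (auto simp: simple_graph_def color_degree_def color_class_def)
qed

lemma sum_card_color:
  fixes t :: nat
  assumes "finite F" "\<And>e. e \<in> F \<Longrightarrow> c e \<in> {1..t}"
  shows "(\<Sum>i\<in>{1..t}. card {e \<in> F. c e = i}) = card F"
  using sum_fun_comp[of F "{1..t}" c "\<lambda>_. 1::nat"] assms by (simp add: image_subset_iff)

lemma card_edges_color_classes:
  assumes "edge_colored_graph t G"
  shows "card (edges G) = (\<Sum>i\<in>{1..t}. card (color_class G i))"
proof -
  have "finite (edges G)" "\<And>e. e \<in> edges G \<Longrightarrow> color G e \<in> {1..t}"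
    using assms finite_edges by (auto simp: edge_colored_graph_def)
  then show ?thesis
    unfolding color_class_def using sum_card_color by metis
qed

lemma degree_color_degrees:
  assumes "edge_colored_graph t G"
  shows "card (incident_edges G v) = (\<Sum>i\<in>{1..t}. color_degree G i v)"
proof -
  have "finite (incident_edges G v)" "\<And>e. e \<in> incident_edges G v \<Longrightarrow> color G e \<in> {1..t}"
    using assms finite_incident_edges by (auto simp: edge_colored_graph_def incident_edges_def)
  then show ?thesis
    unfolding color_degree_def using sum_card_color by metis
qed

lemma not_non_edge_imp_edge:
  assumes "u \<in> verts G" "v \<in> verts G" "u \<noteq> v" "{u, v} \<notin> non_edges G"
  shows "{u, v} \<in> edges G"
  using assms by (auto simp: non_edges_def)

section \<open>Monochromatic stars\<close>

lemma mono_star_free_color_degree_le: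
  assumes "\<not> has_star 3 1 G" "v \<in> verts G"
  shows "color_degree G i v \<le> 2"
proof (rule ccontr)
  assume "\<not> color_degree G i v \<le> 2"
  then have "3 \<le> card {e \<in> incident_edges G v. color G e = i}"
    by (simp add: color_degree_def)
  then obtain F where F: "F \<subseteq> {e \<in> incident_edges G v. color G e = i}" "card F = 3"
    by (rule obtain_subset_with_card_n)
  then have "F \<noteq> {}"
    by auto
  then have "color G ` F = {i}"
    using F(1) by auto
  then have "card (color G ` F) = 1"
    by simp
  moreover have "F \<subseteq> incident_edges G v"
    using F(1) by blast
  ultimately show False
    using F(2) assms unfolding has_star_def by blast
qed

lemma mono_star_free_card_edges_le:
  assumes G: "edge_colored_graph t G" and nostar: "\<not> has_star 3 1 G"
  shows "card (edges G) \<le> t * card (verts G)"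
proof -
  have simple: "simple_graph G"
    using G by (simp add: edge_colored_graph_def)
  have "card (color_class G i) \<le> card (verts G)" for i
  proof -
    have "2 * card (color_class G i) \<le> (\<Sum>v\<in>verts G. 2)"
      unfolding color_degree_sum[OF simple, symmetric]
      using mono_star_free_color_degree_le[OF nostar] by (intro sum_mono) auto
    then show ?thesis
      by simp
  qed
  then have "(\<Sum>i\<in>{1..t}. card (color_class G i)) \<le> (\<Sum>i\<in>{1..t}. card (verts G))"
    by (intro sum_mono) auto
  then show ?thesis
    using card_edges_color_classes[OF G] by simp
qed

lemma blocks_mono_imp_color_degree:
  assumes G: "simple_graph G" and "blocks 3 1 G v i"
  shows "color_degree G i v \<ge> 2"
proof -
  obtain F where F: "F \<subseteq> incident_edges G v" "Suc (card F) = 3"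
    "card (insert i (color G ` F)) = 1"
    using assms(2) unfolding blocks_def by blast
  have "insert i (color G ` F) = {i}"
    using F(3) by (metis card_1_singletonE insertI1 singletonD)
  then have "F \<subseteq> {e \<in> incident_edges G v. color G e = i}"
    using F(1) by auto
  then have "card F \<le> color_degree G i v"
    unfolding color_degree_def using finite_incident_edges[OF G] by (intro card_mono) auto
  then show ?thesis
    using F(2) by simp
qed

lemma card_clique_le_degree:
  assumes G: "simple_graph G" and v: "v \<in> A" and A: "\<And>x. x \<in> A \<Longrightarrow> x \<noteq> v \<Longrightarrow> {v, x} \<in> edges G"
  shows "card A \<le> Suc (card (incident_edges G v))"
proof (cases "finite A")
  case True
  have "inj_on (\<lambda>x. {v, x}) (A - {v})"
    by (auto simp: inj_on_def doubleton_eq_iff)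
  moreover have "(\<lambda>x. {v, x}) ` (A - {v}) \<subseteq> incident_edges G v"
    using A by (auto simp: incident_edges_def)
  ultimately have "card (A - {v}) \<le> card (incident_edges G v)"
    by (rule card_inj_on_le[OF _ _ finite_incident_edges[OF G]])
  then show ?thesis
    using card.remove[OF True v] by simp
qed simp

text \<open>The vertices with at most one edge of color \<open>i\<close> do not block \<open>i\<close> and so form a clique, and
  a clique has at most \<open>2 * t + 1\<close> vertices because all degrees are at most \<open>2 * t\<close>.\<close>

lemma mono_star_saturated_card_edges_ge:
  assumes sat: "saturated t (colorings t 1 (star_graph 3)) G"
  shows "t * (card (verts G) - Suc (2 * t)) \<le> card (edges G)"
proof -
  have G: "edge_colored_graph t G" and nostar: "\<not> has_star 3 1 G"
    and blocks: "\<And>u v i. {u, v} \<in> non_edges G \<Longrightarrow> i \<in> {1..t} \<Longrightarrow>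
      blocks 3 1 G u i \<or> blocks 3 1 G v i"
    using sat by (auto simp: saturated_star_iff)
  have simple: "simple_graph G" and fin: "finite (verts G)"
    using G by (auto simp: edge_colored_graph_def simple_graph_def)
  have "card (verts G) - Suc (2 * t) \<le> card (color_class G i)" if i: "i \<in> {1..t}" for i
  proof -
    define A where "A = {v \<in> verts G. color_degree G i v < 2}"
    have clique: "{u, v} \<in> edges G" if "u \<in> A" "v \<in> A" "u \<noteq> v" for u v
      using that blocks[of u v i] i blocks_mono_imp_color_degree[OF simple]
        not_non_edge_imp_edge[of u G v] by (fastforce simp: A_def)
    have "card A \<le> Suc (2 * t)"
    proof (cases "A = {}")
      case False
      then obtain v where v: "v \<in> A"
        by blast
      have "card (incident_edges G v) \<le> (\<Sum>i\<in>{1..t}. 2)"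
        unfolding degree_color_degrees[OF G]
        using v mono_star_free_color_degree_le[OF nostar] by (intro sum_mono) (auto simp: A_def)
      moreover have "card A \<le> Suc (card (incident_edges G v))"
        using card_clique_le_degree[OF simple v] clique[OF v] by blast
      ultimately show ?thesis
        by simp
    qed simp
    then have "card (verts G) - Suc (2 * t) \<le> card (verts G - A)"
      using diff_card_le_card_Diff[of A "verts G"] fin by (simp add: A_def)
    moreover have "2 * card (verts G - A) \<le> 2 * card (color_class G i)"
    proof -
      have "2 * card (verts G - A) = (\<Sum>v\<in>verts G - A. 2)"
        by simp
      also have "\<dots> \<le> (\<Sum>v\<in>verts G - A. color_degree G i v)"
        by (intro sum_mono) (auto simp: A_def)
      also have "\<dots> \<le> (\<Sum>v\<in>verts G. color_degree G i v)"
        using fin by (intro sum_mono2) auto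
      finally show ?thesis
        by (simp add: color_degree_sum[OF simple])
    qed
    ultimately show ?thesis
      by simp
  qed
  then have "(\<Sum>i\<in>{1..t}. card (verts G) - Suc (2 * t)) \<le> (\<Sum>i\<in>{1..t}. card (color_class G i))"
    by (intro sum_mono) auto
  then show ?thesis
    using card_edges_color_classes[OF G] by simp
qed

section \<open>Two-colored stars\<close>

text \<open>In a properly colored graph every star is rainbow. A vertex with an edge of every color
  blocks each color \<open>i\<close>: take its edge of color \<open>i\<close> and any other one. Hence a non-edge is harmless
  as soon as one endpoint sees all colors, and one exceptional vertex can be tolerated.\<close>

lemma proper_coloring_saturated:
  assumes G: "edge_colored_graph t G" and t: "t \<ge> 2"
    and proper: "\<And>v. inj_on (color G) (incident_edges G v)"
    and full: "\<And>v. v \<in> verts G \<Longrightarrow> v \<noteq> z \<Longrightarrow> {1..t} \<subseteq> color G ` incident_edges G v"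
  shows "saturated t (colorings t 2 (star_graph 3)) G"
proof -
  have nostar: "\<not> has_star 3 2 G"
  proof
    assume "has_star 3 2 G"
    then obtain c F where F: "F \<subseteq> incident_edges G c" "card F = 3" "card (color G ` F) = 2"
      unfolding has_star_def by blast
    then show False
      using card_image[OF inj_on_subset[OF proper F(1)]] by simp
  qed
  have blocks: "blocks 3 2 G v i" if v: "v \<in> verts G" "v \<noteq> z" and i: "i \<in> {1..t}" for v i
  proof -
    have "\<exists>j \<in> {1..t}. j \<noteq> i"
    proof (cases "i = 1")
      case True
      then show ?thesis
        using t by (intro bexI[of _ 2]) auto
    next
      case False
      then show ?thesis
        using t by (intro bexI[of _ 1]) auto
    qed
    then obtain j where j: "j \<in> {1..t}" "j \<noteq> i"
      by blast
    have "i \<in> color G ` incident_edges G v" "j \<in> color G ` incident_edges G v"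
      using full[OF v] i j(1) by blast+
    then obtain e e' where e: "e \<in> incident_edges G v" "color G e = i"
      and e': "e' \<in> incident_edges G v" "color G e' = j"
      by auto
    have "e \<noteq> e'"
      using e e' j by auto
    then show ?thesis
      unfolding blocks_def using e e' j by (intro exI[of _ "{e, e'}"]) auto
  qed
  have "blocks 3 2 G u i \<or> blocks 3 2 G v i"
    if e: "{u, v} \<in> non_edges G" and i: "i \<in> {1..t}" for u v i
  proof -
    have "u \<in> verts G \<and> u \<noteq> z \<or> v \<in> verts G \<and> v \<noteq> z"
      using e by (auto simp: non_edges_def)
    then show ?thesis
      using blocks i by blast
  qed
  then show ?thesis
    using G nostar by (simp add: saturated_star_iff)
qed

text \<open>The complete bipartite graph between \<open>{..<m}\<close> and \<open>{m..<2 * m}\<close> carries the addition table of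
  the integers modulo \<open>m\<close> as a proper coloring. Keeping \<open>t\<close> of its \<open>m\<close> color classes gives a
  \<open>t\<close>-regular graph on \<open>{..<2 * m}\<close>; any further vertices stay isolated.\<close>

definition cyclic_graph :: "nat \<Rightarrow> nat \<Rightarrow> nat \<Rightarrow> nat colored_graph" where
  "cyclic_graph n m t =
     \<lparr>verts = {..<n},
      edges = {{x, y} | x y. x < m \<and> m \<le> y \<and> y < 2 * m \<and> (x + y) mod m < t},
      color = (\<lambda>e. Suc (\<Sum>e mod m))\<rparr>"

lemma mod_add_left_cancel_block:
  fixes a b c m :: nat
  assumes "(a + b) mod m = (a + c) mod m" "b div m = c div m"
  shows "b = c"
proof -
  have "(int a + int b) mod int m = (int a + int c) mod int m"
    using assms(1) by (simp flip: of_nat_add of_nat_mod)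
  moreover have "int x mod int m = ((int a + int x) mod int m - int a) mod int m" for x
    by (simp add: mod_simps)
  ultimately have "int b mod int m = int c mod int m"
    by simp
  then have "b mod m = c mod m"
    by (simp flip: of_nat_mod)
  then show ?thesis
    using assms(2) by (metis div_mult_mod_eq)
qed

lemma cyclic_graph_incident_edges:
  "e \<in> incident_edges (cyclic_graph n m t) v \<longleftrightarrow>
    (\<exists>w. e = {v, w} \<and> v < 2 * m \<and> w < 2 * m \<and> (v < m \<longleftrightarrow> m \<le> w) \<and> (v + w) mod m < t)"
  (is "?L \<longleftrightarrow> ?R")
proof
  assume ?L
  then obtain x y where xy: "e = {x, y}" "x < m" "m \<le> y" "y < 2 * m" "(x + y) mod m < t" "v \<in> e"
    by (auto simp: incident_edges_def cyclic_graph_def)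
  then consider "v = x" | "v = y"
    by blast
  then show ?R
  proof cases
    case 1
    then show ?thesis
      using xy by (intro exI[of _ y]) auto
  next
    case 2
    then show ?thesis
      using xy by (intro exI[of _ x]) (auto simp: add.commute)
  qed
next
  assume ?R
  then obtain w where w: "e = {v, w}" "v < 2 * m" "w < 2 * m" "v < m \<longleftrightarrow> m \<le> w"
    "(v + w) mod m < t"
    by blast
  show ?L
  proof (cases "v < m")
    case True
    then show ?thesis
      using w by (auto simp: incident_edges_def cyclic_graph_def)
  next
    case False
    then have "e = {w, v}" "w < m" "(w + v) mod m < t"
      using w by (auto simp: add.commute)
    then show ?thesis
      using w False by (auto simp: incident_edges_def cyclic_graph_def)
  qed
qed

lemma cyclic_graph_color:
  assumes "v < m \<longleftrightarrow> m \<le> w"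
  shows "color (cyclic_graph n m t) {v, w} = Suc ((v + w) mod m)"
proof -
  have "v \<noteq> w"
    using assms by auto
  then show ?thesis
    by (simp add: cyclic_graph_def)
qed

lemma cyclic_graph_proper:
  "inj_on (color (cyclic_graph n m t)) (incident_edges (cyclic_graph n m t) v)"
proof (rule inj_onI)
  let ?G = "cyclic_graph n m t"
  fix e e' assume e: "e \<in> incident_edges ?G v" and e': "e' \<in> incident_edges ?G v"
    and eq: "color ?G e = color ?G e'"
  obtain w where w: "e = {v, w}" "w < 2 * m" "v < m \<longleftrightarrow> m \<le> w"
    using e by (auto simp: cyclic_graph_incident_edges)
  obtain w' where w': "e' = {v, w'}" "w' < 2 * m" "v < m \<longleftrightarrow> m \<le> w'"
    using e' by (auto simp: cyclic_graph_incident_edges)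
  have "x div m = (if v < m then 1 else 0)" if "x < 2 * m" "v < m \<longleftrightarrow> m \<le> x" for x
  proof (cases "v < m")
    case True
    then show ?thesis
      using that by (simp add: div_nat_eqI)
  next
    case False
    then show ?thesis
      using that by simp
  qed
  then have div: "w div m = w' div m"
    using w w' by simp
  have "(v + w) mod m = (v + w') mod m"
    using eq w w' by (simp add: cyclic_graph_color)
  then have "w = w'"
    using div by (rule mod_add_left_cancel_block)
  then show "e = e'"
    using w w' by simp
qed

lemma cyclic_graph_all_colors:
  assumes v: "v < 2 * m" and t: "t \<le> m"
  shows "{1..t} \<subseteq> color (cyclic_graph n m t) ` incident_edges (cyclic_graph n m t) v"
proof
  fix i assume i: "i \<in> {1..t}"
  define w where "w = (if v < m then m else 0) + (i - 1 + (2 * m - v)) mod m"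
  have "m > 0"
    using v by simp
  then have r: "(i - 1 + (2 * m - v)) mod m < m"
    by simp
  then have w: "w < 2 * m" "v < m \<longleftrightarrow> m \<le> w"
    by (auto simp: w_def)
  have "(v + w) mod m = (v + (i - 1 + (2 * m - v))) mod m"
    by (auto simp: w_def mod_simps add.left_commute[of v m])
  also have "\<dots> = (i - 1 + 2 * m) mod m"
    using v by (simp add: algebra_simps)
  also have "\<dots> = (i - 1) mod m"
    by (rule mod_mult_self1)
  also have "\<dots> = i - 1"
    using i t by (intro mod_less) auto
  finally have sum: "(v + w) mod m = i - 1" .
  then have "(v + w) mod m < t"
    using i by auto
  then have "{v, w} \<in> incident_edges (cyclic_graph n m t) v"
    using w v by (auto simp: cyclic_graph_incident_edges)
  moreover have "color (cyclic_graph n m t) {v, w} = i"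
    using cyclic_graph_color[OF w(2)] sum i by simp
  ultimately show "i \<in> color (cyclic_graph n m t) ` incident_edges (cyclic_graph n m t) v"
    by blast
qed

lemma cyclic_graph_edge_colored:
  assumes "2 * m \<le> n"
  shows "edge_colored_graph t (cyclic_graph n m t)"
proof -
  let ?G = "cyclic_graph n m t"
  have "e \<subseteq> {..<n} \<and> card e = 2 \<and> color ?G e \<in> {1..t}" if e: "e \<in> edges ?G" for e
  proof -
    obtain x y where "e = {x, y}" "x < m" "m \<le> y" "y < 2 * m" "(x + y) mod m < t"
      using e by (auto simp: cyclic_graph_def)
    then show ?thesis
      using assms cyclic_graph_color[of x m y n t] by (auto simp: card_2_iff)
  qed
  moreover have "verts ?G = {..<n}"
    by (simp add: cyclic_graph_def)
  ultimately show ?thesis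
    by (auto simp: edge_colored_graph_def simple_graph_def)
qed

lemma two_colored_star_saturated_exists:
  assumes t: "t \<ge> 2" and n: "n \<ge> 2 * t"
  shows "\<exists>G :: nat colored_graph. saturated t (colorings t 2 (star_graph 3)) G \<and>
    card (verts G) = n \<and> 2 * card (edges G) \<le> t * n"
proof -
  define m where "m = n div 2"
  define G where "G = cyclic_graph n m t"
  have m: "t \<le> m" "2 * m \<le> n"
    using n by (auto simp: m_def)
  have verts: "verts G = {..<n}"
    by (simp add: G_def cyclic_graph_def)
  have G: "edge_colored_graph t G"
    using m by (simp add: G_def cyclic_graph_edge_colored)
  then have simple: "simple_graph G"
    by (simp add: edge_colored_graph_def)
  have proper: "inj_on (color G) (incident_edges G v)" for v
    unfolding G_def by (rule cyclic_graph_proper)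
  (* 2 * m is the isolated vertex of odd n; for even n it is no vertex at all. *)
  have "{1..t} \<subseteq> color G ` incident_edges G v" if "v \<in> verts G" "v \<noteq> 2 * m" for v
  proof -
    have "v < 2 * m"
      using that by (auto simp: verts m_def)
    then show ?thesis
      unfolding G_def using m(1) by (rule cyclic_graph_all_colors)
  qed
  then have "saturated t (colorings t 2 (star_graph 3)) G"
    using proper_coloring_saturated[OF G t proper] by blast
  moreover have "2 * card (edges G) \<le> t * n"
  proof -
    have "card (incident_edges G v) \<le> t" for v
    proof -
      have "color G ` incident_edges G v \<subseteq> {1..t}"
        using G by (auto simp: edge_colored_graph_def incident_edges_def)
      then have "card (incident_edges G v) \<le> card {1..t}"
        by (rule card_inj_on_le[OF proper]) simp
      then show ?thesis
        by simp
    qed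
    then have "(\<Sum>v\<in>verts G. card (incident_edges G v)) \<le> (\<Sum>v\<in>verts G. t)"
      by (intro sum_mono)
    then show ?thesis
      using degree_sum[OF simple] by (simp add: verts mult.commute)
  qed
  ultimately show ?thesis
    using verts by auto
qed

section \<open>Rainbow stars\<close>

text \<open>A vertex cannot block a color \<open>i\<close> that it sees: the two edges that would be completed to a
  rainbow star by a new edge of color \<open>i\<close> already form one with the present edge of color \<open>i\<close>.
  If \<open>u\<close> and \<open>v\<close> were not adjacent, one of them would block color \<open>1\<close> and hence have some edge;
  the color of that edge is seen, and so blocked, by neither of them.\<close>

lemma rainbow_star_saturated_same_colors_adjacent:
  assumes sat: "saturated t (colorings t 3 (star_graph 3)) G" and t: "t \<ge> 1"
    and uv: "u \<in> verts G" "v \<in> verts G" "u \<noteq> v"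
    and same: "color G ` incident_edges G u = color G ` incident_edges G v"
  shows "{u, v} \<in> edges G"
proof (rule ccontr)
  assume "{u, v} \<notin> edges G"
  then have non: "{u, v} \<in> non_edges G"
    using uv not_non_edge_imp_edge by metis
  have G: "edge_colored_graph t G" and nostar: "\<not> has_star 3 3 G"
    and blocks: "\<And>i. i \<in> {1..t} \<Longrightarrow> blocks 3 3 G u i \<or> blocks 3 3 G v i"
    using sat non by (auto simp: saturated_star_iff)
  have fin: "finite (incident_edges G w)" for w
    using G finite_incident_edges by (auto simp: edge_colored_graph_def)
  have not_blocks: "\<not> blocks 3 3 G w i"
    if w: "w \<in> verts G" and i: "i \<in> color G ` incident_edges G w" for w i
  proof
    assume "blocks 3 3 G w i"
    then obtain F where F: "F \<subseteq> incident_edges G w" "Suc (card F) = 3"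
      "card (insert i (color G ` F)) = 3"
      unfolding blocks_def by blast
    obtain e where e: "e \<in> incident_edges G w" "color G e = i"
      using i by blast
    have finF: "finite F"
      using F(1) fin finite_subset by blast
    have "card (color G ` F) \<le> 2"
      using card_image_le[OF finF, of "color G"] F(2) by simp
    then have "i \<notin> color G ` F"
      using F(3) by (auto simp: insert_absorb)
    then have "e \<notin> F"
      using e by auto
    then have "card (insert e F) = 3"
      using finF F(2) by simp
    moreover have "card (color G ` insert e F) = 3"
      using e F(3) by simp
    ultimately show False
      using nostar w e F(1) unfolding has_star_def by (meson insert_subset)
  qed
  have "\<exists>w \<in> {u, v}. \<exists>F \<subseteq> incident_edges G w. Suc (card F) = 3"
    using blocks[of 1] t unfolding blocks_def by auto
  then obtain w F where w: "w \<in> {u, v}" and F: "F \<subseteq> incident_edges G w" "Suc (card F) = 3"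
    by blast
  then obtain e where e: "e \<in> incident_edges G w"
    by (metis card.empty equals0I numeral_One numeral_eq_iff One_nat_def semiring_norm(86) subset_empty)
  let ?i = "color G e"
  have "?i \<in> color G ` incident_edges G u" "?i \<in> color G ` incident_edges G v"
    using e w same by auto
  moreover have "?i \<in> {1..t}"
    using e G by (auto simp: edge_colored_graph_def incident_edges_def)
  ultimately show False
    using blocks not_blocks uv by blast
qed

lemma pigeonhole_fiber:
  assumes "finite V" "finite P" "f ` V \<subseteq> P" "P \<noteq> {}"
  shows "\<exists>p \<in> P. card V \<le> card P * card {v \<in> V. f v = p}"
proof (rule ccontr)
  assume "\<not> ?thesis"
  then have small: "card P * card {v \<in> V. f v = p} < card V" if "p \<in> P" for p
    using that by (meson not_le_imp_less)
  have "card V = (\<Sum>p\<in>P. card {v \<in> V. f v = p})"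
    using sum_fun_comp[of V P f "\<lambda>_. 1::nat"] assms by simp
  then have "card P * card V = (\<Sum>p\<in>P. card P * card {v \<in> V. f v = p})"
    by (simp add: sum_distrib_left)
  also have "\<dots> < (\<Sum>p\<in>P. card V)"
    using small assms by (intro sum_strict_mono) auto
  finally show False
    by simp
qed

text \<open>By pigeonhole some \<open>a\<close> vertices see the same colors, where \<open>a * 2 ^ t\<close> is at least the number of
  vertices, and they span \<open>a * (a - 1) / 2\<close> edges. The bound on the number of vertices is chosen
  to force \<open>a - 1 > 2 * t * 2 ^ t\<close>.\<close>

lemma rainbow_star_saturated_card_edges:
  assumes sat: "saturated t (colorings t 3 (star_graph 3)) G" and t: "t \<ge> 1"
    and n: "card (verts G) \<ge> 2 ^ t * (2 * t * 2 ^ t + 2)"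
  shows "t * card (verts G) < card (edges G)"
proof -
  let ?colors = "\<lambda>v. color G ` incident_edges G v"
  have G: "edge_colored_graph t G"
    using sat by (simp add: saturated_def)
  then have simple: "simple_graph G" and fin: "finite (verts G)"
    by (auto simp: edge_colored_graph_def simple_graph_def)
  have "?colors ` verts G \<subseteq> Pow {1..t}"
    using G by (auto simp: edge_colored_graph_def incident_edges_def)
  then obtain p where p: "card (verts G) \<le> 2 ^ t * card {v \<in> verts G. ?colors v = p}"
    using pigeonhole_fiber[OF fin, of "Pow {1..t}" ?colors] by (auto simp: card_Pow)
  define A where "A = {v \<in> verts G. ?colors v = p}"
  define a where "a = card A"
  have a: "card (verts G) \<le> 2 ^ t * a"
    using p by (simp add: a_def A_def)
  then have "2 ^ t * (2 * t * 2 ^ t + 2) \<le> 2 ^ t * a"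
    using n by (rule le_trans[rotated])
  then have a_ge: "2 * t * 2 ^ t + 2 \<le> a"
    by (rule mult_left_le_imp_le) simp
  have "{e. e \<subseteq> A \<and> card e = 2} \<subseteq> edges G"
  proof
    fix e assume "e \<in> {e. e \<subseteq> A \<and> card e = 2}"
    then obtain u v where uv: "e = {u, v}" "u \<noteq> v" "u \<in> A" "v \<in> A"
      by (auto simp: card_2_iff)
    then show "e \<in> edges G"
      using rainbow_star_saturated_same_colors_adjacent[OF sat t, of u v] by (simp add: A_def)
  qed
  then have "card {e. e \<subseteq> A \<and> card e = 2} \<le> card (edges G)"
    using finite_edges[OF simple] card_mono by blast
  moreover have "finite A"
    using fin by (simp add: A_def)
  ultimately have "a choose 2 \<le> card (edges G)"
    using n_subsets[of A 2] by (simp add: a_def)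
  moreover have "t * card (verts G) < a choose 2"
  proof -
    have "2 * (t * card (verts G)) \<le> a * (2 * t * 2 ^ t)"
      using mult_le_mono2[OF a, of "2 * t"] by (simp add: mult_ac)
    also have "\<dots> < a * (a - 1)"
      using a_ge by (intro mult_strict_left_mono) auto
    also have "\<dots> = 2 * (a choose 2)"
    proof -
      have "even (a * (a - 1))"
        by (cases a) auto
      then show ?thesis
        unfolding choose_two by (rule dvd_mult_div_cancel[symmetric])
    qed
    finally show ?thesis
      by simp
  qed
  ultimately show ?thesis
    by simp
qed

section \<open>Comparing the saturation numbers\<close>

lemma sat_number_attained:
  assumes "r > 0"
  obtains G :: "nat colored_graph" where "saturated t (colorings t r H) G" "card (verts G) = n"
    "sat_number t n (colorings t r H) = card (edges G)"
proof -
  let ?S = "{card (edges G) | G :: nat colored_graph.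
    saturated t (colorings t r H) G \<and> card (verts G) = n}"
  have "\<exists>G :: nat colored_graph. saturated t (colorings t r H) G \<and> card (verts G) = n"
    by (rule saturated_exists) (rule colorings_edges_nonempty[OF assms])
  then have "?S \<noteq> {}"
    by blast
  then have "Inf ?S \<in> ?S"
    by (rule Inf_nat_def1)
  then show thesis
    using that unfolding sat_number_def by auto
qed

lemma sat_number_le:
  fixes G :: "nat colored_graph"
  assumes "saturated t \<C> G"
  shows "sat_number t (card (verts G)) \<C> \<le> card (edges G)"
  unfolding sat_number_def using assms by (intro cInf_lower) auto

theorem theorem2:
  fixes t :: nat
  assumes "t \<ge> 3"
  shows "\<exists>N. \<forall>n \<ge> N.
    sat_number t n (colorings t 2 (star_graph 3)) < sat_number t n (colorings t 1 (star_graph 3)) \<and>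
    sat_number t n (colorings t 1 (star_graph 3)) < sat_number t n (colorings t 3 (star_graph 3))"
proof (intro exI allI impI)
  fix n
  (* The first summand gives t * n / 2 < t * (n - (2 * t + 1)), which separates two colors from one;
     the second one lets the quadratic bound for three colors exceed t * n. *)
  assume n: "n \<ge> (4 * t + 3) + 2 ^ t * (2 * t * 2 ^ t + 2)"
  let ?sat = "\<lambda>r. sat_number t n (colorings t r (star_graph 3))"
  obtain G :: "nat colored_graph" where G: "saturated t (colorings t 1 (star_graph 3)) G"
    "card (verts G) = n" "?sat 1 = card (edges G)"
    using sat_number_attained[of 1] by (metis zero_less_one)
  have lower: "t * (n - Suc (2 * t)) \<le> ?sat 1"
    using mono_star_saturated_card_edges_ge[OF G(1)] G by simp
  have upper: "?sat 1 \<le> t * n"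
    using G mono_star_free_card_edges_le[of t G] by (simp add: saturated_star_iff)
  have "2 * ?sat 2 \<le> t * n"
  proof -
    obtain H :: "nat colored_graph" where "saturated t (colorings t 2 (star_graph 3)) H"
      "card (verts H) = n" "2 * card (edges H) \<le> t * n"
      using two_colored_star_saturated_exists[of t n] assms n by auto
    then show ?thesis
      using sat_number_le by fastforce
  qed
  also have "t * n < t * (2 * (n - Suc (2 * t)))"
    using assms n by (intro mult_strict_left_mono) auto
  also have "\<dots> \<le> 2 * ?sat 1"
    using lower by simp
  finally have "?sat 2 < ?sat 1"
    by simp
  moreover have "t * n < ?sat 3"
  proof -
    obtain H :: "nat colored_graph" where "saturated t (colorings t 3 (star_graph 3)) H"
      "card (verts H) = n" "?sat 3 = card (edges H)"
      using sat_number_attained[of 3] by (metis zero_less_numeral)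
    then show ?thesis
      using rainbow_star_saturated_card_edges[of t H] assms n by simp
  qed
  ultimately show "?sat 2 < ?sat 1 \<and> ?sat 1 < ?sat 3"
    using upper by simp
qed

end
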